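(* Let $\mathbb{H}$ and $\mathbb{K}$ be connected bipartite graphs admitting polarities $\rho_H$ and $\rho_K$, with polarity quotient graphs $P_H(\mathbb{H})$ and $P_K(\mathbb{K})$. Let $P(\mathbb{H}\otimes\mathbb{K})$ be the polarity quotient graph of the Kronecker product $\mathbb{H}\otimes\mathbb{K}$ with respect to the composed polarity $\rho((h,k))=(\rho_H(h),\rho_K(k))$. Then $P(\mathbb{H}\otimes\mathbb{K})$ is isomorphic to the disjoint union $$\bigl(P_H(\mathbb{H})\otimes P_K(\mathbb{K})\bigr)\sqcup\bigl(P_H(\mathbb{H})\otimes P_K(\mathbb{K})\bigr).$$
   Context: Graphs are undirected, without multi-edges; self-loops are allowed (bipartite graphs have none). Kronecker product: for graphs $H,K$, $H\otimes K$ has vertex set $V(H)\times V(K)$, and $((h_1,k_1),(h_2,k_2))$ is an edge if and only if $(h_1,h_2)\in E(H)$ and $(k_1,k_2)\in E(K)$ (so loops of the factors contribute edges). Polarity: for a bipartite graph $\mathbb{G}$ with parts $A,B$, a polarity is a graph automorphism $\rho$ of $\mathbb{G}$ that is an involution with $\rho(A)=B$ and $\rho(B)=A$. The composed polarity $\rho$ is a polarity of the (disconnected, bipartite) graph $\mathbb{H}\otimes\mathbb{K}$. Polarity quotient: $P(\mathbb{G})$ is the graph whose vertices are the orbits $[v]=\{v,\rho(v)\}$, with $[v]$ and $[w]$ adjacent whenever there are $v'\in[v]$, $w'\in[w]$ with $(v',w')\in E(\mathbb{G})$. Multi-edges are merged into one edge, and self-loops (arising when $(v,\rho(v))\in E(\mathbb{G})$)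 are retained. *)

theory Defs
  imports "Graph_Theory.Pair_Digraph" "Graph_Theory.Digraph_Isomorphism"
begin

text \<open>
  An undirected graph without multi-edges, possibly with self-loops and possibly infinite, is a
  \<^locale>\<open>pair_sym_digraph\<close>: an edge between \<open>u\<close> and \<open>v\<close> is the pair of arcs \<open>(u, v)\<close>, \<open>(v, u)\<close>,
  and a self-loop at \<open>v\<close> is the arc \<open>(v, v)\<close>.
\<close>

definition bipartition :: "'a pair_pre_digraph \<Rightarrow> 'a set \<Rightarrow> 'a set \<Rightarrow> bool" where
  "bipartition G A B \<longleftrightarrow> A \<union> B = pverts G \<and> A \<inter> B = {} \<and>
     (\<forall>(u, v) \<in> parcs G. u \<in> A \<and> v \<in> B \<or> u \<in> B \<and> v \<in> A)"

definition automorphism :: "'a pair_pre_digraph \<Rightarrow> ('a \<Rightarrow> 'a) \<Rightarrow> bool" where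
  "automorphism G \<rho> \<longleftrightarrow> bij_betw \<rho> (pverts G) (pverts G) \<and>
     (\<forall>u \<in> pverts G. \<forall>v \<in> pverts G. (\<rho> u, \<rho> v) \<in> parcs G \<longleftrightarrow> (u, v) \<in> parcs G)"

definition polarity :: "'a pair_pre_digraph \<Rightarrow> 'a set \<Rightarrow> 'a set \<Rightarrow> ('a \<Rightarrow> 'a) \<Rightarrow> bool" where
  "polarity G A B \<rho> \<longleftrightarrow> automorphism G \<rho> \<and> (\<forall>v \<in> pverts G. \<rho> (\<rho> v) = v) \<and>
     \<rho> ` A = B \<and> \<rho> ` B = A"

definition kronecker_product ::
  "'a pair_pre_digraph \<Rightarrow> 'b pair_pre_digraph \<Rightarrow> ('a \<times> 'b) pair_pre_digraph" where
  "kronecker_product H K =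
     \<lparr> pverts = pverts H \<times> pverts K,
       parcs = {((h\<^sub>1, k\<^sub>1), (h\<^sub>2, k\<^sub>2)) | h\<^sub>1 k\<^sub>1 h\<^sub>2 k\<^sub>2. (h\<^sub>1, h\<^sub>2) \<in> parcs H \<and> (k\<^sub>1, k\<^sub>2) \<in> parcs K} \<rparr>"

definition orbits :: "'a pair_pre_digraph \<Rightarrow> ('a \<Rightarrow> 'a) \<Rightarrow> 'a set set" where
  "orbits G \<rho> = {{v, \<rho> v} | v. v \<in> pverts G}"

definition polarity_quotient ::
  "'a pair_pre_digraph \<Rightarrow> ('a \<Rightarrow> 'a) \<Rightarrow> 'a set pair_pre_digraph" where
  "polarity_quotient G \<rho> =
     \<lparr> pverts = orbits G \<rho>,
       parcs = {(X, Y). X \<in> orbits G \<rho> \<and> Y \<in> orbits G \<rho> \<and>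
                  (\<exists>x \<in> X. \<exists>y \<in> Y. (x, y) \<in> parcs G)} \<rparr>"

definition disjoint_union ::
  "'a pair_pre_digraph \<Rightarrow> 'b pair_pre_digraph \<Rightarrow> ('a + 'b) pair_pre_digraph" where
  "disjoint_union G H =
     \<lparr> pverts = pverts G <+> pverts H,
       parcs = map_prod Inl Inl ` parcs G \<union> map_prod Inr Inr ` parcs H \<rparr>"

text \<open>The constructions stay within undirected graphs, and the composed map is again a polarity.\<close>

lemma pair_sym_digraph_iff:
  "pair_sym_digraph G \<longleftrightarrow> (\<forall>(u, v) \<in> parcs G. u \<in> pverts G \<and> v \<in> pverts G \<and> (v, u) \<in> parcs G)"
  unfolding pair_sym_digraph_def pair_sym_digraph_axioms_def pair_wf_digraph_def symmetric_def sym_def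
  by auto

lemma pair_sym_digraph_kronecker_product:
  assumes "pair_sym_digraph H" "pair_sym_digraph K"
  shows "pair_sym_digraph (kronecker_product H K)"
  using assms unfolding pair_sym_digraph_iff kronecker_product_def by fastforce

lemma pair_sym_digraph_polarity_quotient:
  assumes "pair_sym_digraph G"
  shows "pair_sym_digraph (polarity_quotient G \<rho>)"
  using assms unfolding pair_sym_digraph_iff polarity_quotient_def by fastforce

lemma pair_sym_digraph_disjoint_union:
  assumes "pair_sym_digraph G" "pair_sym_digraph H"
  shows "pair_sym_digraph (disjoint_union G H)"
  using assms unfolding pair_sym_digraph_iff disjoint_union_def by fastforce

lemma bipartition_kronecker_product:
  assumes "pair_sym_digraph K" "bipartition H A B"
  shows "bipartition (kronecker_product H K) (A \<times> pverts K) (B \<times> pverts K)"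
  using assms unfolding pair_sym_digraph_iff bipartition_def kronecker_product_def by fastforce

lemma polarity_kronecker_product:
  assumes H: "bipartition H A B" "polarity H A B \<rho>\<^sub>H" and K: "polarity K C D \<rho>\<^sub>K"
  shows "polarity (kronecker_product H K) (A \<times> pverts K) (B \<times> pverts K) (map_prod \<rho>\<^sub>H \<rho>\<^sub>K)"
proof -
  have "\<rho>\<^sub>K ` pverts K = pverts K" and "\<rho>\<^sub>H ` A = B" "\<rho>\<^sub>H ` B = A"
    using H K by (auto simp: polarity_def automorphism_def bij_betw_def)
  then have "map_prod \<rho>\<^sub>H \<rho>\<^sub>K ` (A \<times> pverts K) = B \<times> pverts K"
    "map_prod \<rho>\<^sub>H \<rho>\<^sub>K ` (B \<times> pverts K) = A \<times> pverts K"
    by (simp_all add: map_prod_surj_on)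
  moreover have "bij_betw (map_prod \<rho>\<^sub>H \<rho>\<^sub>K) (pverts H \<times> pverts K) (pverts H \<times> pverts K)"
    using H K by (intro bij_betw_map_prod) (auto simp: polarity_def automorphism_def)
  ultimately show ?thesis
    using H K by (auto simp: polarity_def automorphism_def kronecker_product_def)
qed

end

theory Submission
  imports Defs
begin

text \<open>
  A polarity \<open>\<rho>\<close> of a bipartite graph with parts \<open>A\<close>, \<open>B\<close> moves every vertex to the other part, so each
  orbit has exactly one member in \<open>A\<close>. An edge between the orbits of \<open>x, y \<in> A\<close> has to cross the parts,
  so it is \<open>(x, \<rho> y)\<close> or \<open>(\<rho> x, y)\<close>, and \<open>\<rho>\<close> interchanges the two. Hence the polarity quotient is the graph on
  the single part \<open>A\<close> in which \<open>x\<close> and \<open>y\<close> are joined when \<open>(x, \<rho> y)\<close> is an edge; this is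
  \<open>folded_graph\<close>, and \<open>polarity_quotient_arc_iff\<close> is the underlying computation.

  For the product, fold along the part \<open>A \<times> V(K)\<close>. In the folded graph, \<open>(a, k)\<close> and \<open>(a', k')\<close> are
  joined when \<open>(a, \<rho>\<^sub>H a')\<close> and \<open>(k, \<rho>\<^sub>K k')\<close> are edges. The second condition puts \<open>k\<close> and \<open>k'\<close> in the same
  part of \<open>K\<close>, so the folded graph splits into its restrictions to \<open>A \<times> C\<close> and \<open>A \<times> D\<close>. Each of \<open>C\<close> and
  \<open>D\<close> is a transversal of the orbits of \<open>\<rho>\<^sub>K\<close>, so each restriction is a copy of the product of the
  two quotients.
\<close>

lemma digraph_isoI:
  assumes "pair_wf_digraph G" "pair_wf_digraph G'"
    and bij: "bij_betw f (pverts G) (pverts G')"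
    and arcs: "\<And>x y. x \<in> pverts G \<Longrightarrow> y \<in> pverts G \<Longrightarrow> (f x, f y) \<in> parcs G' \<longleftrightarrow> (x, y) \<in> parcs G"
  shows "digraph_iso G G'"
proof -
  define hom where
    "hom = \<lparr>iso_verts = f, iso_arcs = map_prod f f, iso_head = snd, iso_tail = fst\<rparr>"
  have G: "parcs G \<subseteq> pverts G \<times> pverts G" and G': "parcs G' \<subseteq> pverts G' \<times> pverts G'"
    using assms(1,2) by (auto dest: pair_wf_digraph.wellformed')
  have inj: "inj_on f (pverts G)" and img: "f ` pverts G = pverts G'"
    using bij by (auto simp: bij_betw_def)
  have "inj_on (map_prod f f) (parcs G)"
    using map_prod_inj_on[OF inj inj] G by (rule inj_on_subset)
  then have "pre_digraph.digraph_isomorphism G hom"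
    using inj assms(1)
    by (auto simp: pre_digraph.digraph_isomorphism_def hom_def wf_digraph_wp_iff)
  moreover have "map_prod f f ` parcs G = parcs G'"
  proof
    show "map_prod f f ` parcs G \<subseteq> parcs G'"
      using G arcs by auto
    show "parcs G' \<subseteq> map_prod f f ` parcs G"
    proof (rule subrelI)
      fix u v assume uv: "(u, v) \<in> parcs G'"
      then have "u \<in> f ` pverts G" "v \<in> f ` pverts G"
        using G' img by auto
      then obtain x y where "x \<in> pverts G" "y \<in> pverts G" "u = f x" "v = f y"
        by auto
      then show "(u, v) \<in> map_prod f f ` parcs G"
        using uv arcs by force
    qed
  qed
  then have "with_proj G' = app_iso hom G"
    using img by (simp add: app_iso_def hom_def with_proj_def)
  ultimately show ?thesis
    unfolding digraph_iso_def by blast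
qed

lemma polarity_swap:
  assumes "bipartition G A B" "polarity G A B \<rho>"
  shows "bipartition G B A" "polarity G B A \<rho>"
  using assms by (auto simp: bipartition_def polarity_def)

lemma bij_betw_orbits:
  assumes "bipartition G A B" "polarity G A B \<rho>"
  shows "bij_betw (\<lambda>v. {v, \<rho> v}) A (orbits G \<rho>)"
proof (rule bij_betw_imageI)
  have parts: "A \<union> B = pverts G" "A \<inter> B = {}" "\<rho> ` A = B"
    and invol: "\<And>v. v \<in> pverts G \<Longrightarrow> \<rho> (\<rho> v) = v"
    using assms by (auto simp: bipartition_def polarity_def)
  show "inj_on (\<lambda>v. {v, \<rho> v}) A"
    using parts by (auto simp: inj_on_def doubleton_eq_iff)
  show "(\<lambda>v. {v, \<rho> v}) ` A = orbits G \<rho>"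
  proof
    show "(\<lambda>v. {v, \<rho> v}) ` A \<subseteq> orbits G \<rho>"
      using parts by (auto simp: orbits_def)
    show "orbits G \<rho> \<subseteq> (\<lambda>v. {v, \<rho> v}) ` A"
    proof
      fix X assume "X \<in> orbits G \<rho>"
      then obtain v where v: "v \<in> pverts G" "X = {v, \<rho> v}"
        by (auto simp: orbits_def)
      show "X \<in> (\<lambda>v. {v, \<rho> v}) ` A"
      proof (cases "v \<in> A")
        case True
        then show ?thesis using v by blast
      next
        case False
        then obtain w where "w \<in> A" "v = \<rho> w" using v parts by blast
        moreover have "\<rho> (\<rho> w) = w" using \<open>w \<in> A\<close> invol parts by auto
        ultimately have "X = {w, \<rho> w}" using v by auto
        then show ?thesis using \<open>w \<in> A\<close> by blast
      qed
    qed
  qed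
qed

text \<open>
  Of the four possible edges between the two orbits, \<open>(x, y)\<close> and \<open>(\<rho> x, \<rho> y)\<close> stay inside a part, and
  \<open>\<rho>\<close> maps \<open>(\<rho> x, y)\<close> to \<open>(x, \<rho> y)\<close>.
\<close>
lemma polarity_quotient_arc_iff:
  assumes "bipartition G A B" "polarity G A B \<rho>" and x: "x \<in> A" and y: "y \<in> A"
  shows "({x, \<rho> x}, {y, \<rho> y}) \<in> parcs (polarity_quotient G \<rho>) \<longleftrightarrow> (x, \<rho> y) \<in> parcs G"
proof -
  have verts: "x \<in> pverts G" "y \<in> pverts G" "\<rho> x \<in> B" "\<rho> y \<in> B" "\<rho> x \<in> pverts G" "\<rho> y \<in> pverts G"
    using assms by (auto simp: bipartition_def polarity_def)
  have "(x, y) \<notin> parcs G" "(\<rho> x, \<rho> y) \<notin> parcs G"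
    using assms verts by (auto simp: bipartition_def)
  moreover have "(\<rho> x, y) \<in> parcs G \<longleftrightarrow> (x, \<rho> y) \<in> parcs G"
    using assms(2) verts unfolding polarity_def automorphism_def by metis
  moreover have "{x, \<rho> x} \<in> orbits G \<rho>" "{y, \<rho> y} \<in> orbits G \<rho>"
    using verts by (auto simp: orbits_def)
  ultimately show ?thesis
    by (auto simp: polarity_quotient_def)
qed

definition folded_graph :: "'a pair_pre_digraph \<Rightarrow> 'a set \<Rightarrow> ('a \<Rightarrow> 'a) \<Rightarrow> 'a pair_pre_digraph" where
  "folded_graph G A \<rho> = \<lparr>pverts = A, parcs = {(x, y). x \<in> A \<and> y \<in> A \<and> (x, \<rho> y) \<in> parcs G}\<rparr>"

lemma pair_wf_digraph_folded_graph: "pair_wf_digraph (folded_graph G A \<rho>)"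
  by (auto simp: pair_wf_digraph_def folded_graph_def)

lemma pair_wf_digraph_polarity_quotient: "pair_wf_digraph (polarity_quotient G \<rho>)"
  by (auto simp: pair_wf_digraph_def polarity_quotient_def)

lemma polarity_quotient_iso_folded_graph:
  assumes "bipartition G A B" "polarity G A B \<rho>"
  shows "digraph_iso (polarity_quotient G \<rho>) (folded_graph G A \<rho>)"
proof (rule digraph_iso_swap)
  show "digraph_iso (folded_graph G A \<rho>) (polarity_quotient G \<rho>)"
  proof (rule digraph_isoI)
    show "bij_betw (\<lambda>v. {v, \<rho> v}) (pverts (folded_graph G A \<rho>)) (pverts (polarity_quotient G \<rho>))"
      using bij_betw_orbits[OF assms] by (simp add: folded_graph_def polarity_quotient_def)
    show "({x, \<rho> x}, {y, \<rho> y}) \<in> parcs (polarity_quotient G \<rho>) \<longleftrightarrow>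
        (x, y) \<in> parcs (folded_graph G A \<rho>)"
      if "x \<in> pverts (folded_graph G A \<rho>)" "y \<in> pverts (folded_graph G A \<rho>)" for x y
      using that polarity_quotient_arc_iff[OF assms] by (simp add: folded_graph_def)
  qed (rule pair_wf_digraph_folded_graph pair_wf_digraph_polarity_quotient)+
qed (simp add: wf_digraph_wp_iff pair_wf_digraph_folded_graph)

text \<open>
  The isomorphism sends \<open>(a, k)\<close> to the pair of orbits of \<open>a\<close> and \<open>k\<close>, and the part of \<open>K\<close> that contains
  \<open>k\<close> selects the copy. The part has to be recorded because \<open>(a, k)\<close> and \<open>(a, \<rho>\<^sub>K k)\<close> are distinct
  vertices of the folded graph with the same pair of orbits.
\<close>
lemma folded_graph_kronecker_product_iso:
  assumes H: "bipartition H A B" "polarity H A B \<rho>\<^sub>H"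
    and K: "bipartition K C D" "polarity K C D \<rho>\<^sub>K"
  defines "P \<equiv> kronecker_product (polarity_quotient H \<rho>\<^sub>H) (polarity_quotient K \<rho>\<^sub>K)"
  shows "digraph_iso
     (folded_graph (kronecker_product H K) (A \<times> pverts K) (map_prod \<rho>\<^sub>H \<rho>\<^sub>K)) (disjoint_union P P)"
proof -
  let ?F = "folded_graph (kronecker_product H K) (A \<times> pverts K) (map_prod \<rho>\<^sub>H \<rho>\<^sub>K)"
  define q where "q = map_prod (\<lambda>h. {h, \<rho>\<^sub>H h}) (\<lambda>k. {k, \<rho>\<^sub>K k})"
  define f where "f p = (if snd p \<in> C then Inl (q p) else Inr (q p))" for p
  note K' = polarity_swap[OF K]
  have CD: "C \<union> D = pverts K" "C \<inter> D = {}" "\<rho>\<^sub>K ` C = D" "\<rho>\<^sub>K ` D = C"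
    using K by (auto simp: bipartition_def polarity_def)
  have pverts_P: "pverts P = orbits H \<rho>\<^sub>H \<times> orbits K \<rho>\<^sub>K"
    by (simp add: P_def kronecker_product_def polarity_quotient_def)
  have parcs_P: "((X, Y), (X', Y')) \<in> parcs P \<longleftrightarrow>
      (X, X') \<in> parcs (polarity_quotient H \<rho>\<^sub>H) \<and> (Y, Y') \<in> parcs (polarity_quotient K \<rho>\<^sub>K)"
    for X X' Y Y'
    by (simp add: P_def kronecker_product_def)
  have q_C: "bij_betw q (A \<times> C) (pverts P)" and q_D: "bij_betw q (A \<times> D) (pverts P)"
    unfolding q_def pverts_P
    by (intro bij_betw_map_prod bij_betw_orbits[OF H] bij_betw_orbits[OF K] bij_betw_orbits[OF K'])+
  show ?thesis
  proof (rule digraph_isoI)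
    show "pair_wf_digraph ?F"
      by (rule pair_wf_digraph_folded_graph)
    show "pair_wf_digraph (disjoint_union P P)"
      by (auto simp: pair_wf_digraph_def disjoint_union_def P_def kronecker_product_def
          polarity_quotient_def)
    have "bij_betw Inl (pverts P) (Inl ` pverts P)" "bij_betw Inr (pverts P) (Inr ` pverts P)"
      by (simp_all add: bij_betw_def)
    with q_C q_D have "bij_betw (Inl \<circ> q) (A \<times> C) (Inl ` pverts P)"
      "bij_betw (Inr \<circ> q) (A \<times> D) (Inr ` pverts P)"
      by (blast intro: bij_betw_trans)+
    moreover have "bij_betw f (A \<times> C) S \<longleftrightarrow> bij_betw (Inl \<circ> q) (A \<times> C) S"
      "bij_betw f (A \<times> D) S \<longleftrightarrow> bij_betw (Inr \<circ> q) (A \<times> D) S" for S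
      using CD(2) by (auto simp: f_def intro!: bij_betw_cong)
    ultimately have "bij_betw f (A \<times> C) (Inl ` pverts P)" "bij_betw f (A \<times> D) (Inr ` pverts P)"
      by simp_all
    then have "bij_betw f (A \<times> C \<union> A \<times> D) (Inl ` pverts P \<union> Inr ` pverts P)"
      by (rule bij_betw_combine) auto
    then show "bij_betw f (pverts ?F) (pverts (disjoint_union P P))"
      using CD(1) by (simp add: folded_graph_def disjoint_union_def Plus_def
          Sigma_Un_distrib2[symmetric])
  next
    fix p p' assume "p \<in> pverts ?F" "p' \<in> pverts ?F"
    then obtain a k a' k' where p: "p = (a, k)" "p' = (a', k')"
      and verts: "a \<in> A" "a' \<in> A" "k \<in> pverts K" "k' \<in> pverts K"
      by (auto simp: folded_graph_def)
    have arc: "(p, p') \<in> parcs ?F \<longleftrightarrow> (a, \<rho>\<^sub>H a') \<in> parcs H \<and> (k, \<rho>\<^sub>K k') \<in> parcs K"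
      using verts by (simp add: p folded_graph_def kronecker_product_def)
    show "(f p, f p') \<in> parcs (disjoint_union P P) \<longleftrightarrow> (p, p') \<in> parcs ?F"
    proof (cases "k \<in> C \<longleftrightarrow> k' \<in> C")
      case True
      then have same_part: "k \<in> C \<and> k' \<in> C \<or> k \<in> D \<and> k' \<in> D"
        using verts CD(1) by blast
      from True have "(f p, f p') \<in> parcs (disjoint_union P P) \<longleftrightarrow> (q p, q p') \<in> parcs P"
        by (auto simp: p f_def disjoint_union_def)
      also have "\<dots> \<longleftrightarrow> ({a, \<rho>\<^sub>H a}, {a', \<rho>\<^sub>H a'}) \<in> parcs (polarity_quotient H \<rho>\<^sub>H) \<and>
          ({k, \<rho>\<^sub>K k}, {k', \<rho>\<^sub>K k'}) \<in> parcs (polarity_quotient K \<rho>\<^sub>K)"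
        by (simp add: p q_def parcs_P)
      also have "\<dots> \<longleftrightarrow> (p, p') \<in> parcs ?F"
        using same_part verts polarity_quotient_arc_iff[OF H] polarity_quotient_arc_iff[OF K]
          polarity_quotient_arc_iff[OF K']
        by (auto simp: arc)
      finally show ?thesis .
    next
      \<comment> \<open>Here \<open>k\<close> and \<open>\<rho>\<^sub>K k'\<close> lie in the same part of \<open>K\<close>, so neither side has an arc.\<close>
      case False
      then have "k \<in> C \<and> \<rho>\<^sub>K k' \<in> C \<or> k \<in> D \<and> \<rho>\<^sub>K k' \<in> D"
        using verts CD by blast
      then have "(k, \<rho>\<^sub>K k') \<notin> parcs K"
        using K(1) by (auto simp: bipartition_def)
      then show ?thesis
        using False unfolding arc by (auto simp: p f_def disjoint_union_def)
    qed
  qed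
qed

theorem corollary5p1:
  fixes H :: "'a pair_pre_digraph" and K :: "'b pair_pre_digraph"
    and A B :: "'a set" and C D :: "'b set"
    and \<rho>\<^sub>H :: "'a \<Rightarrow> 'a" and \<rho>\<^sub>K :: "'b \<Rightarrow> 'b"
  assumes "pair_sym_digraph H" and "connected H" and "bipartition H A B" and "polarity H A B \<rho>\<^sub>H"
    and "pair_sym_digraph K" and "connected K" and "bipartition K C D" and "polarity K C D \<rho>\<^sub>K"
  shows "digraph_iso
     (polarity_quotient (kronecker_product H K) (map_prod \<rho>\<^sub>H \<rho>\<^sub>K))
     (disjoint_union
        (kronecker_product (polarity_quotient H \<rho>\<^sub>H) (polarity_quotient K \<rho>\<^sub>K))
        (kronecker_product (polarity_quotient H \<rho>\<^sub>H) (polarity_quotient K \<rho>\<^sub>K)))"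
proof (rule digraph_iso_trans)
  show "digraph_iso (polarity_quotient (kronecker_product H K) (map_prod \<rho>\<^sub>H \<rho>\<^sub>K))
     (folded_graph (kronecker_product H K) (A \<times> pverts K) (map_prod \<rho>\<^sub>H \<rho>\<^sub>K))"
    by (rule polarity_quotient_iso_folded_graph[OF bipartition_kronecker_product
          polarity_kronecker_product]) fact+
qed (rule folded_graph_kronecker_product_iso; fact)

end
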